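(* For each $(d,j)\in\mathbb N[D]\times\mathbb N[M-1]$: if $\overline\omega_d(T^{\rm b}_j)=\underline\omega_d(T^{\rm b}_j)$ and $\overline\omega_d(T^{\rm b}_{j+1})=\underline\omega_d(T^{\rm b}_{j+1})$, let $$\overline r'_{d,j}:=\underline r'_{d,j}:=\left(\overline\omega_d(T^{\rm b}_{j+1})-\overline\omega_d(T^{\rm b}_j)\right)/\Delta^{\rm b}_j;$$ otherwise let $\overline r'_{d,j}:=\overline r_d$ and $\underline r'_{d,j}:=\underline r_d$. Put $\overline r'_j:=(\overline r'_{1,j},\ldots,\overline r'_{D,j})\in\mathbb R^D$ and $\underline r'_j:=(\underline r'_{1,j},\ldots,\underline r'_{D,j})\in\mathbb R^D$. Let $(\sigma_1,\ldots,\sigma_{2^D})$ be any enumeration (permutation) of $\{0,1\}^D$. For every $\alpha\in\mathbb R^{G\times D}$ and $\beta_{1:M}=(\beta_1,\ldots,\beta_M)$ with $\beta_j\in\mathbb R^G$, writing $g_j:=(\beta_{j+1}-\beta_j)/\Delta^{\rm b}_j\in\mathbb R^G$, the condition $$\underline R\le\frac{\hat x_{\alpha,\beta_{1:M}}(\xi,t_2)-\hat x_{\alpha,\beta_{1:M}}(\xi,t_1)}{t_2-t_1}\le\overline R\quad\forall(\xi,t_1,t_2)\in\Omega\times\mathcal T^{\rm o}$$ holds if and only if $$\underline R\le\alpha\left(\underline r'_j+\sigma_l\circ(\overline r'_j-\underline r'_j)\right)+g_j\le\overline R\quad\forall(j,l)\in\mathbb N[M-1]\times\mathbb N[2^D]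.$$
   Context: Notation: $\mathbb N[n]:=\{1,\ldots,n\}$; $\circ$ is the entrywise product of vectors; vector inequalities are entrywise; $G,D$ are positive integers (numbers of generators and loads); $T\in(0,\infty)$, $\mathcal T:=[0,T]$; $\mathcal C_n$ is the set of continuous functions $\mathcal T\to\mathbb R^n$; $\mathcal T^{\rm o}:=\{(t_1,t_2)\in\mathcal T^2:t_1<t_2\}$. $\overline R\in\mathbb R^G_+$ (entrywise nonnegative) and $\underline R\in\mathbb R^G_-$ (entrywise nonpositive) are the ramp-up and ramp-down limits of the generators. Demand data: for each $d\in\mathbb N[D]$, $\Xi_d$ is a given set, with at least two elements, of functions $\xi_d:\mathcal T\to\mathbb R$. With $R(\xi_d,t_1,t_2):=(\xi_d(t_2)-\xi_d(t_1))/(t_2-t_1)$, it is assumed that $\overline r_d:=\sup\{R(\xi_d,t_1,t_2):\xi_d\in\Xi_d,(t_1,t_2)\in\mathcal T^{\rm o}\}<\infty$ and $\underline r_d:=\inf\{R(\xi_d,t_1,t_2):\xi_d\in\Xi_d,(t_1,t_2)\in\mathcal T^{\rm o}\}>-\infty$. Superset $\Omega$: fix an integer $N\ge2$ and equally spaced points $0=T_1<T_2<\cdots<T_N=T$. Let $i(t):=j$ if $t\in[T_j,T_{j+1})$ and $i(T):=N-1$. Let $\overline\omega'_d(t):=\sup\{\xi_d(\tau):\xi_d\in\Xi_d,\tau\in[T_{i(t)},T_{i(t)+1}]\}$ and $\underline\omega'_d(t):=\inf\{\xi_d(\tau):\xi_d\in\Xi_d,\tau\in[T_{i(t)},T_{i(t)+1}]\}$,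 assumed finite. Let $$\Omega_d:=\{\xi_d\in\mathcal C_1:\underline\omega'_d(t)\le\xi_d(t)\le\overline\omega'_d(t)\ \forall t\in\mathcal T,\ \underline r_d\le R(\xi_d,t_1,t_2)\le\overline r_d\ \forall(t_1,t_2)\in\mathcal T^{\rm o}\},\quad \Omega:=\Omega_1\times\cdots\times\Omega_D\subset\mathcal C_D.$$ Envelopes $\overline\omega_d,\underline\omega_d\in\mathcal C_1$: each is the continuous piecewise affine function determined by its breakpoints and its values there (convention $0/0=0$). For $j\in\mathbb N[N-2]$ let $\overline\omega'^{+}_{d,j}:=\overline\omega'_d(T_{j+1})-\overline\omega'_d(T_j)$ and $\underline\omega'^{+}_{d,j}:=\underline\omega'_d(T_{j+1})-\underline\omega'_d(T_j)$. Breakpoints of $\overline\omega_d$: $\overline{\mathcal T}^{\rm b}_d:=\{T_1,\ldots,T_N\}\cup\{\overline T^{\rm b}_{d,1},\ldots,\overline T^{\rm b}_{d,N-2}\}$, where $\overline T^{\rm b}_{d,j}:=T_{j+1}+\overline\omega'^{+}_{d,j}/\overline r_d$ if $\overline\omega'^{+}_{d,j}\ge0$, and $T_{j+1}-\overline\omega'^{+}_{d,j}/\underline r_d$ otherwise. Values: $\overline\omega_d(T_1):=\overline\omega'_d(T_1)$; $\overline\omega_d(T_{j+1}):=\min\{\overline\omega'_d(T_j),\overline\omega'_d(T_{j+1})\}$ for $j\in\mathbb N[N-1]$; $\overline\omega_d(\overline T^{\rm b}_{d,j}):=\max\{\overline\omega'_d(T_j),\overline\omega'_d(T_{j+1})\}$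 for $j\in\mathbb N[N-2]$. Breakpoints of $\underline\omega_d$: $\underline{\mathcal T}^{\rm b}_d:=\{T_1,\ldots,T_N\}\cup\{\underline T^{\rm b}_{d,1},\ldots,\underline T^{\rm b}_{d,N-2}\}$, where $\underline T^{\rm b}_{d,j}:=T_{j+1}-\underline\omega'^{+}_{d,j}/\overline r_d$ if $\underline\omega'^{+}_{d,j}\ge0$, and $T_{j+1}+\underline\omega'^{+}_{d,j}/\underline r_d$ otherwise. Values: $\underline\omega_d(T_1):=\underline\omega'_d(T_1)$; $\underline\omega_d(T_{j+1}):=\max\{\underline\omega'_d(T_j),\underline\omega'_d(T_{j+1})\}$ for $j\in\mathbb N[N-1]$; $\underline\omega_d(\underline T^{\rm b}_{d,j}):=\min\{\underline\omega'_d(T_j),\underline\omega'_d(T_{j+1})\}$ for $j\in\mathbb N[N-2]$. Standing property of the setting: $\overline\omega_d$ and $\underline\omega_d$ belong to $\Omega_d$ and are its pointwise largest and smallest elements, and $\{\xi_d(t):\xi_d\in\Omega_d\}=[\underline\omega_d(t),\overline\omega_d(t)]$ for all $t\in\mathcal T$. Decision rule: let $\mathcal T^{\rm b}:=\bigcup_{d\in\mathbb N[D]}(\overline{\mathcal T}^{\rm b}_d\cup\underline{\mathcal T}^{\rm b}_d)=\{T^{\rm b}_1,\ldots,T^{\rm b}_M\}$ with $0=T^{\rm b}_1<\cdots<T^{\rm b}_M=T$, $M=|\mathcal T^{\rm b}|$, and $\Delta^{\rm b}_j:=T^{\rm b}_{j+1}-T^{\rm b}_j$. Let $k(t):=j$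 if $t\in[T^{\rm b}_j,T^{\rm b}_{j+1})$, $k(T):=M-1$; $\gamma(t):=(t-T^{\rm b}_{k(t)})/\Delta^{\rm b}_{k(t)}$ for $t\in[0,T)$, $\gamma(T):=1$. For $\alpha\in\mathbb R^{G\times D}$ and $\beta_1,\ldots,\beta_M\in\mathbb R^G$, and $\xi\in\Omega$, $t\in\mathcal T$, $$\hat x_{\alpha,\beta_{1:M}}(\xi,t):=\alpha\xi(t)+(1-\gamma(t))\beta_{k(t)}+\gamma(t)\beta_{k(t)+1}\in\mathbb R^G.$$ *)

theory Defs
  imports "HOL-Analysis.Analysis"
begin

text \<open>
  Functions on the time horizon \<open>[0, T]\<close> are represented by total functions on the reals whose
  values outside \<open>[0, T]\<close> are irrelevant. Load and generator indices range over finite types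
  \<open>'d\<close> and \<open>'g\<close>; breakpoint and interval indices are natural numbers starting at 1.
  Definitions concerning a single load take its demand set \<open>X\<close> as a parameter. On vectors,
  \<open>\<le>\<close> and \<open>*\<close> are the library's entrywise order and entrywise product.
\<close>

definition time_pairs :: "real \<Rightarrow> (real \<times> real) set" where
  "time_pairs T = {(t1, t2). t1 \<in> {0..T} \<and> t2 \<in> {0..T} \<and> t1 < t2}"

definition ramp :: "(real \<Rightarrow> real) \<Rightarrow> real \<Rightarrow> real \<Rightarrow> real" where
  "ramp \<xi> t1 t2 = (\<xi> t2 - \<xi> t1) / (t2 - t1)"

definition ramps :: "real \<Rightarrow> (real \<Rightarrow> real) set \<Rightarrow> real set" where
  "ramps T X = {ramp \<xi> t1 t2 | \<xi> t1 t2. \<xi> \<in> X \<and> (t1, t2) \<in> time_pairs T}"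

definition ramp_sup :: "real \<Rightarrow> (real \<Rightarrow> real) set \<Rightarrow> real" where
  "ramp_sup T X = Sup (ramps T X)"

definition ramp_inf :: "real \<Rightarrow> (real \<Rightarrow> real) set \<Rightarrow> real" where
  "ramp_inf T X = Inf (ramps T X)"

definition grid :: "real \<Rightarrow> nat \<Rightarrow> nat \<Rightarrow> real" where
  "grid T N j = real (j - 1) * T / real (N - 1)"

text \<open>
  For \<open>p 1 < \<dots> < p n\<close>, the index \<open>j\<close> with \<open>p j \<le> t < p (j + 1)\<close>; the right end point \<open>p n\<close>
  belongs to the last interval.
\<close>

definition cell :: "(nat \<Rightarrow> real) \<Rightarrow> nat \<Rightarrow> real \<Rightarrow> nat" where
  "cell p n t = (if t = p n then n - 1
     else THE j. j \<in> {1..n - 1} \<and> p j \<le> t \<and> t < p (j + 1))"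

definition cell_values :: "real \<Rightarrow> nat \<Rightarrow> (real \<Rightarrow> real) set \<Rightarrow> real \<Rightarrow> real set" where
  "cell_values T N X t = (let i = cell (grid T N) N t in
     {\<xi> \<tau> | \<xi> \<tau>. \<xi> \<in> X \<and> \<tau> \<in> {grid T N i..grid T N (i + 1)}})"

definition step_upper :: "real \<Rightarrow> nat \<Rightarrow> (real \<Rightarrow> real) set \<Rightarrow> real \<Rightarrow> real" where
  "step_upper T N X t = Sup (cell_values T N X t)"

definition step_lower :: "real \<Rightarrow> nat \<Rightarrow> (real \<Rightarrow> real) set \<Rightarrow> real \<Rightarrow> real" where
  "step_lower T N X t = Inf (cell_values T N X t)"

definition Omega_load :: "real \<Rightarrow> nat \<Rightarrow> (real \<Rightarrow> real) set \<Rightarrow> (real \<Rightarrow> real) set" where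
  "Omega_load T N X = {\<xi>. continuous_on {0..T} \<xi>
     \<and> (\<forall>t\<in>{0..T}. step_lower T N X t \<le> \<xi> t \<and> \<xi> t \<le> step_upper T N X t)
     \<and> (\<forall>(t1, t2)\<in>time_pairs T. ramp_inf T X \<le> ramp \<xi> t1 t2 \<and> ramp \<xi> t1 t2 \<le> ramp_sup T X)}"

definition Omega ::
  "real \<Rightarrow> nat \<Rightarrow> ('d::finite \<Rightarrow> (real \<Rightarrow> real) set) \<Rightarrow> (real \<Rightarrow> real ^ 'd) set" where
  "Omega T N \<Xi> = {\<xi>. \<forall>d. (\<lambda>t. \<xi> t $ d) \<in> Omega_load T N (\<Xi> d)}"

definition nth_point :: "real set \<Rightarrow> nat \<Rightarrow> real" where
  "nth_point B j = sorted_list_of_set B ! (j - 1)"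

text \<open>
  The piecewise affine function with breakpoints \<open>B\<close> through the points \<open>P\<close>, where \<open>P\<close> contains
  exactly one point above each element of \<open>B\<close>.
\<close>

definition pw_affine :: "real set \<Rightarrow> (real \<times> real) set \<Rightarrow> real \<Rightarrow> real" where
  "pw_affine B P t = (let
       v = (\<lambda>b. THE y. (b, y) \<in> P);
       k = cell (nth_point B) (card B) t;
       a = nth_point B k;
       b = nth_point B (k + 1)
     in v a + (t - a) / (b - a) * (v b - v a))"

definition jump_upper :: "real \<Rightarrow> nat \<Rightarrow> (real \<Rightarrow> real) set \<Rightarrow> nat \<Rightarrow> real" where
  "jump_upper T N X j = step_upper T N X (grid T N (j + 1)) - step_upper T N X (grid T N j)"

definition jump_lower :: "real \<Rightarrow> nat \<Rightarrow> (real \<Rightarrow> real) set \<Rightarrow> nat \<Rightarrow> real" where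
  "jump_lower T N X j = step_lower T N X (grid T N (j + 1)) - step_lower T N X (grid T N j)"

text \<open>The convention \<open>0 / 0 = 0\<close> needed below is the one of the library.\<close>

definition bp_upper :: "real \<Rightarrow> nat \<Rightarrow> (real \<Rightarrow> real) set \<Rightarrow> nat \<Rightarrow> real" where
  "bp_upper T N X j = (if jump_upper T N X j \<ge> 0
     then grid T N (j + 1) + jump_upper T N X j / ramp_sup T X
     else grid T N (j + 1) - jump_upper T N X j / ramp_inf T X)"

definition bp_lower :: "real \<Rightarrow> nat \<Rightarrow> (real \<Rightarrow> real) set \<Rightarrow> nat \<Rightarrow> real" where
  "bp_lower T N X j = (if jump_lower T N X j \<ge> 0
     then grid T N (j + 1) - jump_lower T N X j / ramp_sup T X
     else grid T N (j + 1) + jump_lower T N X j / ramp_inf T X)"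

definition bps_upper :: "real \<Rightarrow> nat \<Rightarrow> (real \<Rightarrow> real) set \<Rightarrow> real set" where
  "bps_upper T N X = grid T N ` {1..N} \<union> bp_upper T N X ` {1..N - 2}"

definition bps_lower :: "real \<Rightarrow> nat \<Rightarrow> (real \<Rightarrow> real) set \<Rightarrow> real set" where
  "bps_lower T N X = grid T N ` {1..N} \<union> bp_lower T N X ` {1..N - 2}"

definition points_upper :: "real \<Rightarrow> nat \<Rightarrow> (real \<Rightarrow> real) set \<Rightarrow> (real \<times> real) set" where
  "points_upper T N X = (let u = (\<lambda>j. step_upper T N X (grid T N j)) in
     {(grid T N 1, u 1)}
     \<union> (\<lambda>j. (grid T N (j + 1), min (u j) (u (j + 1)))) ` {1..N - 1}
     \<union> (\<lambda>j. (bp_upper T N X j, max (u j) (u (j + 1)))) ` {1..N - 2})"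

definition points_lower :: "real \<Rightarrow> nat \<Rightarrow> (real \<Rightarrow> real) set \<Rightarrow> (real \<times> real) set" where
  "points_lower T N X = (let l = (\<lambda>j. step_lower T N X (grid T N j)) in
     {(grid T N 1, l 1)}
     \<union> (\<lambda>j. (grid T N (j + 1), max (l j) (l (j + 1)))) ` {1..N - 1}
     \<union> (\<lambda>j. (bp_lower T N X j, min (l j) (l (j + 1)))) ` {1..N - 2})"

definition env_upper :: "real \<Rightarrow> nat \<Rightarrow> (real \<Rightarrow> real) set \<Rightarrow> real \<Rightarrow> real" where
  "env_upper T N X = pw_affine (bps_upper T N X) (points_upper T N X)"

definition env_lower :: "real \<Rightarrow> nat \<Rightarrow> (real \<Rightarrow> real) set \<Rightarrow> real \<Rightarrow> real" where
  "env_lower T N X = pw_affine (bps_lower T N X) (points_lower T N X)"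

definition bps :: "real \<Rightarrow> nat \<Rightarrow> ('d::finite \<Rightarrow> (real \<Rightarrow> real) set) \<Rightarrow> real set" where
  "bps T N \<Xi> = (\<Union>d. bps_upper T N (\<Xi> d) \<union> bps_lower T N (\<Xi> d))"

definition num_bps :: "real \<Rightarrow> nat \<Rightarrow> ('d::finite \<Rightarrow> (real \<Rightarrow> real) set) \<Rightarrow> nat" where
  "num_bps T N \<Xi> = card (bps T N \<Xi>)"

definition bp :: "real \<Rightarrow> nat \<Rightarrow> ('d::finite \<Rightarrow> (real \<Rightarrow> real) set) \<Rightarrow> nat \<Rightarrow> real" where
  "bp T N \<Xi> = nth_point (bps T N \<Xi>)"

definition bp_gap :: "real \<Rightarrow> nat \<Rightarrow> ('d::finite \<Rightarrow> (real \<Rightarrow> real) set) \<Rightarrow> nat \<Rightarrow> real" where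
  "bp_gap T N \<Xi> j = bp T N \<Xi> (j + 1) - bp T N \<Xi> j"

definition bp_index :: "real \<Rightarrow> nat \<Rightarrow> ('d::finite \<Rightarrow> (real \<Rightarrow> real) set) \<Rightarrow> real \<Rightarrow> nat" where
  "bp_index T N \<Xi> t = cell (bp T N \<Xi>) (num_bps T N \<Xi>) t"

definition bp_frac :: "real \<Rightarrow> nat \<Rightarrow> ('d::finite \<Rightarrow> (real \<Rightarrow> real) set) \<Rightarrow> real \<Rightarrow> real" where
  "bp_frac T N \<Xi> t = (if t = T then 1
     else (t - bp T N \<Xi> (bp_index T N \<Xi> t)) / bp_gap T N \<Xi> (bp_index T N \<Xi> t))"

definition x_hat ::
  "real \<Rightarrow> nat \<Rightarrow> ('d::finite \<Rightarrow> (real \<Rightarrow> real) set) \<Rightarrow> real ^ 'd ^ 'g \<Rightarrow> (nat \<Rightarrow> real ^ 'g)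
    \<Rightarrow> (real \<Rightarrow> real ^ 'd) \<Rightarrow> real \<Rightarrow> real ^ 'g::finite" where
  "x_hat T N \<Xi> \<alpha> \<beta> \<xi> t = \<alpha> *v \<xi> t
     + (1 - bp_frac T N \<Xi> t) *\<^sub>R \<beta> (bp_index T N \<Xi> t)
     + bp_frac T N \<Xi> t *\<^sub>R \<beta> (bp_index T N \<Xi> t + 1)"

definition envs_meet ::
  "real \<Rightarrow> nat \<Rightarrow> ('d::finite \<Rightarrow> (real \<Rightarrow> real) set) \<Rightarrow> 'd \<Rightarrow> nat \<Rightarrow> bool" where
  "envs_meet T N \<Xi> d j \<longleftrightarrow>
     env_upper T N (\<Xi> d) (bp T N \<Xi> j) = env_lower T N (\<Xi> d) (bp T N \<Xi> j)
     \<and> env_upper T N (\<Xi> d) (bp T N \<Xi> (j + 1)) = env_lower T N (\<Xi> d) (bp T N \<Xi> (j + 1))"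

definition env_slope ::
  "real \<Rightarrow> nat \<Rightarrow> ('d::finite \<Rightarrow> (real \<Rightarrow> real) set) \<Rightarrow> 'd \<Rightarrow> nat \<Rightarrow> real" where
  "env_slope T N \<Xi> d j =
     (env_upper T N (\<Xi> d) (bp T N \<Xi> (j + 1)) - env_upper T N (\<Xi> d) (bp T N \<Xi> j)) / bp_gap T N \<Xi> j"

definition ramp_sup' ::
  "real \<Rightarrow> nat \<Rightarrow> ('d::finite \<Rightarrow> (real \<Rightarrow> real) set) \<Rightarrow> nat \<Rightarrow> real ^ 'd" where
  "ramp_sup' T N \<Xi> j =
     (\<chi> d. if envs_meet T N \<Xi> d j then env_slope T N \<Xi> d j else ramp_sup T (\<Xi> d))"

definition ramp_inf' ::
  "real \<Rightarrow> nat \<Rightarrow> ('d::finite \<Rightarrow> (real \<Rightarrow> real) set) \<Rightarrow> nat \<Rightarrow> real ^ 'd" where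
  "ramp_inf' T N \<Xi> j =
     (\<chi> d. if envs_meet T N \<Xi> d j then env_slope T N \<Xi> d j else ramp_inf T (\<Xi> d))"

end

theory Submission
  imports Defs
begin

text \<open>
  Call the intervals between consecutive points of \<open>\<T>\<^sup>b\<close> cells. On a cell the decision rule has
  difference quotients \<open>\<alpha> \<rho> + g\<^sub>j\<close>, where \<open>\<rho>\<close> is the vector of difference quotients of the loads,
  so everything depends on which vectors \<open>\<rho>\<close> occur on cell \<open>j\<close>. They are exactly the points of
  the box between \<open>ramp_inf'\<close> and \<open>ramp_sup'\<close>.

  No other vector occurs (\<open>ramp_in_bp_cell\<close>): both envelopes of a load are affine on a cell, so if
  they agree at its two ends they agree throughout, and every admissible load is then forced to be
  that affine function; otherwise the bounds are the ramp bounds that define \<open>\<Omega>\<close>.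
  Every vector of the box does occur (\<open>ramp_attained_in_bp_cell\<close>): if the envelopes differ at an end
  of the cell, they differ at its midpoint. A line of the prescribed slope through the middle of
  this gap, clamped between the envelopes, is an admissible load
  (\<open>exists_load_with_local_ramp\<close>), and it coincides with the line on a short interval. As there
  are finitely many loads, one interval serves all of them, and \<open>\<Omega>\<close> is a product.

  Two reductions remain. Bounds on the difference quotients over the cells give the same bounds
  over the whole horizon, because such bounds say that two auxiliary functions are monotone, and
  monotonicity glues (\<open>difference_quotient_bounds_iff_mono\<close>, \<open>mono_on_glue\<close>). And an affine function
  satisfies bounds on a box if and only if it does so at the vertices
  (\<open>matrix_bounds_on_box_iff_vertices\<close>).

  The cells make up exactly the horizon only if no breakpoint of an envelope lies outside
  \<open>[0, T]\<close>. This follows from the ramp bounds on the demand data: the step functions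
  cannot jump by more than what can be ramped in one grid interval (\<open>jump_bounds\<close>).
\<close>

section \<open>Cells of an increasing sequence\<close>

lemma cell_eqI:
  assumes p: "strict_mono_on {1..n} p" and k: "k \<in> {1..n - 1}" and t: "p k \<le> t" "t < p (k + 1)"
  shows "cell p n t = k"
proof -
  have mono: "p i \<le> p j" if "i \<in> {1..n}" "j \<in> {1..n}" "i \<le> j" for i j
    using strict_mono_on_leD[OF p] that by blast
  have "p (k + 1) \<le> p n" using mono k by auto
  hence "t \<noteq> p n" using t by auto
  moreover have "(THE j. j \<in> {1..n - 1} \<and> p j \<le> t \<and> t < p (j + 1)) = k"
  proof (rule the_equality)
    fix j assume j: "j \<in> {1..n - 1} \<and> p j \<le> t \<and> t < p (j + 1)"
    show "j = k"
    proof (rule ccontr)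
      assume "j \<noteq> k"
      then consider "j + 1 \<le> k" | "k + 1 \<le> j" by linarith
      thus False
      proof cases
        case 1
        hence "p (j + 1) \<le> p k" using mono j k by auto
        thus False using j t by linarith
      next
        case 2
        hence "p (k + 1) \<le> p j" using mono j k by auto
        thus False using j t by linarith
      qed
    qed
  qed (use k t in auto)
  ultimately show ?thesis by (simp add: cell_def)
qed

lemma cell_last: "cell p n (p n) = n - 1"
  by (simp add: cell_def)

text \<open>
  At the right end of a cell the index \<open>cell\<close> already refers to the next cell, except at the last
  point. Both formulas give \<open>v (k + 1)\<close> there, so interpolation on a cell is valid on its closure.
\<close>

lemma interpolation_on_closed_cell:
  fixes v :: "nat \<Rightarrow> 'a::real_vector"
  assumes p: "strict_mono_on {1..n} p" and k: "k \<in> {1..n - 1}" and t: "t \<in> {p k..p (k + 1)}"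
  defines "i \<equiv> cell p n t"
  shows "v i + ((t - p i) / (p (i + 1) - p i)) *\<^sub>R (v (i + 1) - v i)
       = v k + ((t - p k) / (p (k + 1) - p k)) *\<^sub>R (v (k + 1) - v k)"
proof -
  have less: "p k < p (k + 1)" using strict_mono_onD[OF p] k by auto
  consider "t < p (k + 1)" | "t = p (k + 1)" "k = n - 1" | "t = p (k + 1)" "k + 1 \<in> {1..n - 1}"
    using t k by fastforce
  thus ?thesis
  proof cases
    case 1
    hence "i = k" unfolding i_def using cell_eqI[OF p k] t by simp
    thus ?thesis by simp
  next
    case 2
    hence "i = k" unfolding i_def using cell_last[of p n] k by simp
    thus ?thesis by simp
  next
    case 3
    have "p (k + 1) < p (k + 1 + 1)" using strict_mono_onD[OF p] 3 by auto
    hence "i = k + 1" unfolding i_def using cell_eqI[OF p 3(2)] 3 by simp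
    thus ?thesis using 3 less by simp
  qed
qed

lemma exists_cell:
  fixes p :: "nat \<Rightarrow> 'a::linorder"
  assumes "1 \<le> n" "p 1 \<le> t" "t < p n"
  obtains k where "k \<in> {1..n - 1}" "p k \<le> t" "t < p (k + 1)"
proof -
  let ?k = "Max {k \<in> {1..n}. p k \<le> t}"
  have k: "?k \<in> {k \<in> {1..n}. p k \<le> t}"
    using assms by (intro Max_in) auto
  hence "?k \<noteq> n" using assms by auto
  hence "?k \<in> {1..n - 1}" using k by auto
  moreover have "t < p (?k + 1)"
  proof (rule ccontr)
    assume "\<not> t < p (?k + 1)"
    hence "?k + 1 \<in> {k \<in> {1..n}. p k \<le> t}" using \<open>?k \<in> {1..n - 1}\<close> by auto
    hence "?k + 1 \<le> ?k" by (intro Max_ge) auto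
    thus False by simp
  qed
  ultimately show ?thesis using that k by auto
qed

section \<open>Piecewise affine functions\<close>

lemma strict_mono_on_nth_point: "strict_mono_on {1..card B} (nth_point B)"
  unfolding nth_point_def
  by (intro strict_mono_onI strict_sorted_list_of_set[THEN sorted_wrt_nth_less]) auto

lemma nth_point_image:
  assumes "finite B" shows "nth_point B ` {1..card B} = B"
proof -
  have "nth_point B ` {1..card B} = (\<lambda>i. sorted_list_of_set B ! i) ` (\<lambda>j. j - 1) ` {1..card B}"
    by (simp add: image_image nth_point_def)
  also have "(\<lambda>j. j - 1) ` {1..card B} = {..<card B}"
    by (auto intro!: image_eqI[of _ _ "Suc _"])
  also have "(\<lambda>i. sorted_list_of_set B ! i) ` {..<card B} = set (sorted_list_of_set B)"
    by (auto simp: set_conv_nth image_iff)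
  finally show ?thesis using assms by simp
qed

lemma nth_point_mem: "finite B \<Longrightarrow> k \<in> {1..card B} \<Longrightarrow> nth_point B k \<in> B"
  using nth_point_image by blast

lemma nth_point_obtain:
  assumes "finite B" "x \<in> B"
  obtains i where "i \<in> {1..card B}" "nth_point B i = x"
  using nth_point_image[OF assms(1)] assms(2) by (metis imageE)

lemma nth_point_ends:
  assumes B: "finite B" and a: "a \<in> B" "b \<in> B" "\<And>x. x \<in> B \<Longrightarrow> a \<le> x \<and> x \<le> b"
  shows "nth_point B 1 = a" "nth_point B (card B) = b"
proof -
  have card: "card B \<ge> 1" using B a(1) by (metis One_nat_def Suc_leI card_gt_0_iff empty_iff)
  have mono: "nth_point B i \<le> nth_point B j" if "i \<in> {1..card B}" "j \<in> {1..card B}" "i \<le> j" for i j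
    using strict_mono_on_leD[OF strict_mono_on_nth_point] that by blast
  obtain i where "i \<in> {1..card B}" "nth_point B i = a" using nth_point_obtain[OF B] a by metis
  hence "nth_point B 1 \<le> a" using mono[of 1 i] card by auto
  moreover have "nth_point B 1 \<in> B" "nth_point B (card B) \<in> B" using nth_point_mem[OF B] card by auto
  moreover obtain i where "i \<in> {1..card B}" "nth_point B i = b" using nth_point_obtain[OF B] a by metis
  hence "b \<le> nth_point B (card B)" using mono[of i "card B"] card by auto
  ultimately show "nth_point B 1 = a" "nth_point B (card B) = b" using a(3) by (auto intro: antisym)
qed

lemma no_point_between_consecutive:
  assumes "finite B" and j: "j \<in> {1..card B - 1}"
  shows "{nth_point B j<..<nth_point B (j + 1)} \<inter> B = {}"
proof -
  have "nth_point B i \<le> nth_point B j \<or> nth_point B (j + 1) \<le> nth_point B i" if "i \<in> {1..card B}" for i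
  proof (cases "i \<le> j")
    case True
    thus ?thesis using strict_mono_on_leD[OF strict_mono_on_nth_point, of i B j] that j by auto
  next
    case False
    thus ?thesis using strict_mono_on_leD[OF strict_mono_on_nth_point, of "j + 1" B i] that j by auto
  qed
  hence "x \<le> nth_point B j \<or> nth_point B (j + 1) \<le> x" if "x \<in> B" for x
    using nth_point_obtain[OF assms(1) that] by metis
  thus ?thesis by (meson disjoint_iff greaterThanLessThan_iff not_le)
qed

text \<open>
  An interval without breakpoints in its interior lies in one closed cell of \<open>B\<close>, and there
  \<open>pw_affine\<close> interpolates between two values.
\<close>

lemma pw_affine_affine_off_breakpoints:
  assumes B: "finite B" and ends: "lo \<in> B" "hi \<in> B" "\<And>x. x \<in> B \<Longrightarrow> lo \<le> x \<and> x \<le> hi"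
    and ab: "lo \<le> a" "a < b" "b \<le> hi" and gap: "{a<..<b} \<inter> B = {}"
  obtains c m where "\<And>t. t \<in> {a..b} \<Longrightarrow> pw_affine B P t = c + m * t"
proof -
  let ?p = "nth_point B"
  define v where "v = (\<lambda>k. THE y. (?p k, y) \<in> P)"
  note e = nth_point_ends[OF B ends]
  have "1 \<le> card B" using B ends(1) by (auto simp: Suc_le_eq card_gt_0_iff)
  then obtain k where k: "k \<in> {1..card B - 1}" "?p k \<le> a" "a < ?p (k + 1)"
    using exists_cell[of "card B" ?p a] e ab by auto
  have "?p (k + 1) \<in> B" using k by (intro nth_point_mem B) auto
  hence "b \<le> ?p (k + 1)" using gap k(3) by force
  define m where "m = (v (k + 1) - v k) / (?p (k + 1) - ?p k)"
  have "pw_affine B P t = (v k - m * ?p k) + m * t" if "t \<in> {a..b}" for t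
  proof -
    have "t \<in> {?p k..?p (k + 1)}" using that k \<open>b \<le> ?p (k + 1)\<close> by auto
    from interpolation_on_closed_cell[OF strict_mono_on_nth_point k(1) this, of v]
    have "pw_affine B P t = v k + (t - ?p k) / (?p (k + 1) - ?p k) * (v (k + 1) - v k)"
      by (simp add: pw_affine_def Let_def v_def)
    thus ?thesis by (simp add: m_def divide_inverse algebra_simps)
  qed
  thus ?thesis by (rule that)
qed

section \<open>Extremes of affine maps on boxes\<close>

text \<open>
  In row \<open>g\<close>, each summand is smallest and largest at an end of its interval, and the sign of
  \<open>\<alpha> $ g $ d\<close> decides which. So the extremes of each component are attained at vertices
  (a different one for each row).
\<close>

lemma matrix_bounds_from_box_vertices:
  fixes \<alpha> :: "real ^ 'd::finite ^ 'g::finite"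
  assumes vert: "\<And>s :: real ^ 'd. \<forall>d. s $ d \<in> {0, 1} \<Longrightarrow>
      L \<le> \<alpha> *v (lo + s * (hi - lo)) + c \<and> \<alpha> *v (lo + s * (hi - lo)) + c \<le> U"
    and box: "lo \<le> \<rho>" "\<rho> \<le> hi"
  shows "L \<le> \<alpha> *v \<rho> + c" "\<alpha> *v \<rho> + c \<le> U"
proof -
  have b: "lo $ d \<le> \<rho> $ d" "\<rho> $ d \<le> hi $ d" for d using box by (auto simp: less_eq_vec_def)
  have "L $ g \<le> (\<alpha> *v \<rho> + c) $ g \<and> (\<alpha> *v \<rho> + c) $ g \<le> U $ g" for g
  proof
    define s1 :: "real ^ 'd" where "s1 = (\<chi> d. if \<alpha> $ g $ d \<ge> 0 then 0 else 1)"
    define s2 :: "real ^ 'd" where "s2 = (\<chi> d. if \<alpha> $ g $ d \<ge> 0 then 1 else 0)"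
    have "L $ g \<le> (\<alpha> *v (lo + s1 * (hi - lo)) + c) $ g"
      using vert[of s1] by (auto simp: s1_def less_eq_vec_def)
    also have "\<dots> \<le> (\<alpha> *v \<rho> + c) $ g"
    proof -
      have "\<alpha> $ g $ d * (lo + s1 * (hi - lo)) $ d \<le> \<alpha> $ g $ d * \<rho> $ d" for d
        using b[of d] by (simp add: s1_def mult_left_mono mult_left_mono_neg)
      thus ?thesis by (simp add: matrix_vector_mult_def sum_mono)
    qed
    finally show "L $ g \<le> (\<alpha> *v \<rho> + c) $ g" .
    have "(\<alpha> *v \<rho> + c) $ g \<le> (\<alpha> *v (lo + s2 * (hi - lo)) + c) $ g"
    proof -
      have "\<alpha> $ g $ d * \<rho> $ d \<le> \<alpha> $ g $ d * (lo + s2 * (hi - lo)) $ d" for d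
        using b[of d] by (simp add: s2_def mult_left_mono mult_left_mono_neg)
      thus ?thesis by (simp add: matrix_vector_mult_def sum_mono)
    qed
    also have "\<dots> \<le> U $ g"
      using vert[of s2] by (auto simp: s2_def less_eq_vec_def)
    finally show "(\<alpha> *v \<rho> + c) $ g \<le> U $ g" .
  qed
  thus "L \<le> \<alpha> *v \<rho> + c" "\<alpha> *v \<rho> + c \<le> U" by (auto simp: less_eq_vec_def)
qed

lemma matrix_bounds_on_box_iff_vertices:
  fixes \<alpha> :: "real ^ 'd::finite ^ 'g::finite"
  assumes "lo \<le> hi"
  shows "(\<forall>\<rho>. lo \<le> \<rho> \<longrightarrow> \<rho> \<le> hi \<longrightarrow> L \<le> \<alpha> *v \<rho> + c \<and> \<alpha> *v \<rho> + c \<le> U)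
    \<longleftrightarrow> (\<forall>s\<in>{s. \<forall>d. s $ d \<in> {0, 1}}.
          L \<le> \<alpha> *v (lo + s * (hi - lo)) + c \<and> \<alpha> *v (lo + s * (hi - lo)) + c \<le> U)"
proof -
  have "lo \<le> lo + s * (hi - lo)" "lo + s * (hi - lo) \<le> hi"
    if s: "\<forall>d. s $ d \<in> {0, 1}" for s :: "real ^ 'd"
  proof -
    have "lo $ d \<le> (lo + s * (hi - lo)) $ d \<and> (lo + s * (hi - lo)) $ d \<le> hi $ d" for d
    proof -
      have "lo $ d \<le> hi $ d" using assms by (simp add: less_eq_vec_def)
      moreover have "s $ d = 0 \<or> s $ d = 1" using s by simp
      ultimately show ?thesis by auto
    qed
    thus "lo \<le> lo + s * (hi - lo)" "lo + s * (hi - lo) \<le> hi" by (simp_all add: less_eq_vec_def)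
  qed
  moreover have "L \<le> \<alpha> *v \<rho> + c \<and> \<alpha> *v \<rho> + c \<le> U"
    if "\<forall>s\<in>{s. \<forall>d. s $ d \<in> {0, 1}}.
          L \<le> \<alpha> *v (lo + s * (hi - lo)) + c \<and> \<alpha> *v (lo + s * (hi - lo)) + c \<le> U"
      and "lo \<le> \<rho>" "\<rho> \<le> hi" for \<rho>
    using matrix_bounds_from_box_vertices[of L \<alpha> lo hi c U \<rho>] that by simp
  ultimately show ?thesis by blast
qed

section \<open>Bounds on difference quotients\<close>

lemma mono_on_glue:
  fixes p :: "nat \<Rightarrow> 'a::linorder" and h :: "'a \<Rightarrow> 'b::preorder"
  assumes "1 \<le> n" and "\<And>j. j \<in> {1..n - 1} \<Longrightarrow> p j \<le> p (j + 1)"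
    and "\<And>j. j \<in> {1..n - 1} \<Longrightarrow> mono_on {p j..p (j + 1)} h"
  shows "mono_on {p 1..p n} h"
  using assms
proof (induction n rule: nat_induct_at_least)
  case base
  show ?case by (simp add: mono_on_def)
next
  case (Suc n)
  have left: "mono_on {p 1..p n} h" by (rule Suc.IH; rule Suc.prems) auto
  have right: "mono_on {p n..p (Suc n)} h" using Suc.prems(2)[of n] Suc.hyps by auto
  show ?case
  proof (rule mono_onI)
    fix r s assume rs: "r \<in> {p 1..p (Suc n)}" "s \<in> {p 1..p (Suc n)}" "r \<le> s"
    consider "s \<le> p n" | "p n \<le> r" | "r \<le> p n" "p n \<le> s" by (meson linear)
    thus "h r \<le> h s"
    proof cases
      case 1 show ?thesis by (rule mono_onD[OF left]) (use rs 1 in auto)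
    next
      case 2 show ?thesis by (rule mono_onD[OF right]) (use rs 2 in auto)
    next
      case 3
      have "h r \<le> h (p n)" using mono_onD[OF left, of r "p n"] rs 3 by auto
      also have "h (p n) \<le> h s" using mono_onD[OF right, of "p n" s] rs 3 by auto
      finally show ?thesis .
    qed
  qed
qed

text \<open>
  Clearing the denominator turns bounds on difference quotients into monotonicity, which
  passes from adjacent intervals to their union without weighted averages of quotients.
\<close>

lemma difference_quotient_bounds_iff_mono:
  fixes x :: "real \<Rightarrow> 'a::ordered_real_vector"
  shows "(\<forall>s\<in>I. \<forall>t\<in>I. s < t \<longrightarrow> L \<le> (x t - x s) /\<^sub>R (t - s) \<and> (x t - x s) /\<^sub>R (t - s) \<le> U)
    \<longleftrightarrow> mono_on I (\<lambda>t. x t - t *\<^sub>R L) \<and> mono_on I (\<lambda>t. t *\<^sub>R U - x t)" (is "?l \<longleftrightarrow> ?r")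
proof -
  have "L \<le> (x t - x s) /\<^sub>R (t - s) \<and> (x t - x s) /\<^sub>R (t - s) \<le> U
      \<longleftrightarrow> x s - s *\<^sub>R L \<le> x t - t *\<^sub>R L \<and> s *\<^sub>R U - x s \<le> t *\<^sub>R U - x t"
    if "s < t" for s t
  proof -
    have "L \<le> (x t - x s) /\<^sub>R (t - s) \<longleftrightarrow> (t - s) *\<^sub>R L \<le> x t - x s"
      "(x t - x s) /\<^sub>R (t - s) \<le> U \<longleftrightarrow> x t - x s \<le> (t - s) *\<^sub>R U"
      using that by (simp_all only: pos_le_divideR_eq pos_divideR_le_eq diff_gt_0_iff_gt)
    thus ?thesis by (simp add: algebra_simps)
  qed
  hence "?l \<longleftrightarrow> (\<forall>s\<in>I. \<forall>t\<in>I. s < t \<longrightarrow>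
      x s - s *\<^sub>R L \<le> x t - t *\<^sub>R L \<and> s *\<^sub>R U - x s \<le> t *\<^sub>R U - x t)"
    by (intro ball_cong refl imp_cong) auto
  also have "\<dots> \<longleftrightarrow> ?r"
  proof -
    have strict: "mono_on I f \<longleftrightarrow> (\<forall>s\<in>I. \<forall>t\<in>I. s < t \<longrightarrow> f s \<le> f t)" for f :: "real \<Rightarrow> 'a"
    proof
      assume less: "\<forall>s\<in>I. \<forall>t\<in>I. s < t \<longrightarrow> f s \<le> f t"
      show "mono_on I f"
      proof (rule mono_onI)
        fix s t assume "s \<in> I" "t \<in> I" "s \<le> t"
        thus "f s \<le> f t" using less by (cases "s = t") auto
      qed
    qed (simp add: mono_on_def)
    show ?thesis unfolding strict by blast
  qed
  finally show ?thesis .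
qed

section \<open>The breakpoints lie in the time horizon\<close>

lemma grid_first: "grid T N 1 = 0"
  by (simp add: grid_def)

lemma grid_last: "2 \<le> N \<Longrightarrow> grid T N N = T"
  by (simp add: grid_def)

lemma grid_Suc: "1 \<le> j \<Longrightarrow> grid T N (j + 1) = grid T N j + T / real (N - 1)"
  by (cases j) (simp_all add: grid_def field_simps add_divide_distrib)

lemma strict_mono_on_grid:
  assumes "0 < T" "2 \<le> N" shows "strict_mono_on {1..N} (grid T N)"
  using assms by (intro strict_mono_onI) (auto simp: grid_def divide_simps)

lemma grid_bounds:
  assumes "0 < T" "2 \<le> N" "j \<in> {1..N}" shows "0 \<le> grid T N j" "grid T N j \<le> T"
  using strict_mono_on_leD[OF strict_mono_on_grid[OF assms(1,2)], of 1 j]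
    strict_mono_on_leD[OF strict_mono_on_grid[OF assms(1,2)], of j N] assms
  by (simp_all add: grid_first[simplified] grid_last)

lemma cell_values_grid:
  assumes "0 < T" "2 \<le> N" "j \<in> {1..N - 1}"
  shows "cell_values T N X (grid T N j) = {\<xi> \<tau> | \<xi> \<tau>. \<xi> \<in> X \<and> \<tau> \<in> {grid T N j..grid T N (j + 1)}}"
proof -
  have "cell (grid T N) N (grid T N j) = j"
    using strict_mono_onD[OF strict_mono_on_grid[OF assms(1,2)], of j "j + 1"] assms(3)
    by (intro cell_eqI[OF strict_mono_on_grid[OF assms(1,2)]]) auto
  thus ?thesis by (simp add: cell_values_def Let_def)
qed

lemma ramp_bounds:
  assumes "bdd_above (ramps T X)" "bdd_below (ramps T X)" "\<xi> \<in> X" "0 \<le> s" "s \<le> t" "t \<le> T"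
  shows "ramp_inf T X * (t - s) \<le> \<xi> t - \<xi> s" "\<xi> t - \<xi> s \<le> ramp_sup T X * (t - s)"
proof -
  have "ramp_inf T X \<le> ramp \<xi> s t \<and> ramp \<xi> s t \<le> ramp_sup T X" if "s < t"
  proof -
    have "(s, t) \<in> time_pairs T" using assms that by (simp add: time_pairs_def)
    hence "ramp \<xi> s t \<in> ramps T X" unfolding ramps_def using assms(3) by blast
    thus ?thesis unfolding ramp_inf_def ramp_sup_def
      using assms by (auto intro: cInf_lower cSup_upper)
  qed
  thus "ramp_inf T X * (t - s) \<le> \<xi> t - \<xi> s" "\<xi> t - \<xi> s \<le> ramp_sup T X * (t - s)"
    using assms(5) by (cases "s = t"; force simp: ramp_def pos_le_divide_eq pos_divide_le_eq)+
qed

text \<open>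
  The two-sided matching of elements carries over to suprema and infima alike, so the jumps
  of the upper and of the lower step function are bounded by one argument.
\<close>

lemma Sup_Inf_differences:
  fixes A B :: "real set"
  assumes ne: "A \<noteq> {}" "B \<noteq> {}" and bdd: "bdd_above A" "bdd_below A" "bdd_above B" "bdd_below B"
    and AB: "\<And>a. a \<in> A \<Longrightarrow> \<exists>w\<in>B. w - a \<in> {-m..M}"
    and BA: "\<And>b. b \<in> B \<Longrightarrow> \<exists>w\<in>A. b - w \<in> {-m..M}"
  shows "Sup B - Sup A \<in> {-m..M}" "Inf B - Inf A \<in> {-m..M}"
proof -
  have "Sup A \<le> Sup B + m"
  proof (rule cSup_least[OF ne(1)])
    fix a assume "a \<in> A"
    then obtain w where "w \<in> B" "w - a \<in> {-m..M}" using AB by blast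
    thus "a \<le> Sup B + m" using cSup_upper[OF _ bdd(3), of w] by auto
  qed
  moreover have "Sup B \<le> Sup A + M"
  proof (rule cSup_least[OF ne(2)])
    fix b assume "b \<in> B"
    then obtain w where "w \<in> A" "b - w \<in> {-m..M}" using BA by blast
    thus "b \<le> Sup A + M" using cSup_upper[OF _ bdd(1), of w] by auto
  qed
  moreover have "Inf B - M \<le> Inf A"
  proof (rule cInf_greatest[OF ne(1)])
    fix a assume "a \<in> A"
    then obtain w where "w \<in> B" "w - a \<in> {-m..M}" using AB by blast
    thus "Inf B - M \<le> a" using cInf_lower[OF _ bdd(4), of w] by auto
  qed
  moreover have "Inf A - m \<le> Inf B"
  proof (rule cInf_greatest[OF ne(2)])
    fix b assume "b \<in> B"
    then obtain w where "w \<in> A" "b - w \<in> {-m..M}" using BA by blast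
    thus "Inf A - m \<le> b" using cInf_lower[OF _ bdd(2), of w] by auto
  qed
  ultimately show "Sup B - Sup A \<in> {-m..M}" "Inf B - Inf A \<in> {-m..M}" by auto
qed

text \<open>
  Adjacent grid intervals share a grid point. Any value of a demand function on one of them differs
  from its value at this point by at most what can be ramped in time \<open>h\<close>. The ramp bounds may
  have either sign, hence the maxima with 0.
\<close>

lemma jump_bounds:
  assumes T: "0 < T" "2 \<le> N" and X: "X \<noteq> {}"
    and ramps: "bdd_above (ramps T X)" "bdd_below (ramps T X)"
    and vals: "\<And>t. t \<in> {0..T} \<Longrightarrow> bdd_above (cell_values T N X t)"
      "\<And>t. t \<in> {0..T} \<Longrightarrow> bdd_below (cell_values T N X t)"
    and j: "j \<in> {1..N - 2}"
  defines "h \<equiv> T / real (N - 1)"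
  shows "jump_upper T N X j \<in> {- (max 0 (- ramp_inf T X) * h)..max 0 (ramp_sup T X) * h}"
    and "jump_lower T N X j \<in> {- (max 0 (- ramp_inf T X) * h)..max 0 (ramp_sup T X) * h}"
proof -
  let ?g = "grid T N" let ?m = "max 0 (- ramp_inf T X) * h" let ?M = "max 0 (ramp_sup T X) * h"
  define A where "A = cell_values T N X (?g j)"
  define B where "B = cell_values T N X (?g (j + 1))"
  have A: "A = {\<xi> \<tau> | \<xi> \<tau>. \<xi> \<in> X \<and> \<tau> \<in> {?g j..?g (j + 1)}}"
    unfolding A_def by (rule cell_values_grid) (use T j in auto)
  have B: "B = {\<xi> \<tau> | \<xi> \<tau>. \<xi> \<in> X \<and> \<tau> \<in> {?g (j + 1)..?g (j + 1 + 1)}}"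
    unfolding B_def by (rule cell_values_grid) (use T j in auto)
  have h: "0 < h" using T by (simp add: h_def)
  have g: "?g (j + 1) = ?g j + h" "?g (j + 1 + 1) = ?g (j + 1) + h"
    using grid_Suc[of j T N] grid_Suc[of "j + 1" T N] j by (auto simp: h_def)
  have in01: "?g i \<in> {0..T}" if "i \<in> {j, j + 1, j + 1 + 1}" for i
    using grid_bounds[OF T, of i] that j by auto
  have diff: "\<xi> t - \<xi> s \<in> {-?m..?M}" if "\<xi> \<in> X" "?g j \<le> s" "s \<le> t" "t \<le> ?g (j + 1 + 1)" "t - s \<le> h" for \<xi> s t
  proof -
    have b: "ramp_inf T X * (t - s) \<le> \<xi> t - \<xi> s" "\<xi> t - \<xi> s \<le> ramp_sup T X * (t - s)"
      using ramp_bounds[OF ramps that(1), of s t] that in01[of j] in01[of "j + 1 + 1"] by auto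
    have "ramp_sup T X * (t - s) \<le> max 0 (ramp_sup T X) * (t - s)"
      using that by (intro mult_right_mono) auto
    also have "\<dots> \<le> ?M" using that by (intro mult_left_mono) auto
    finally have 1: "ramp_sup T X * (t - s) \<le> ?M" .
    have "- ramp_inf T X * (t - s) \<le> max 0 (- ramp_inf T X) * (t - s)"
      using that by (intro mult_right_mono) auto
    also have "\<dots> \<le> ?m" using that by (intro mult_left_mono) auto
    finally show ?thesis using b 1 by auto
  qed
  have node: "\<xi> (?g (j + 1)) \<in> A" "\<xi> (?g (j + 1)) \<in> B" if "\<xi> \<in> X" for \<xi>
  proof -
    have "?g (j + 1) \<in> {?g j..?g (j + 1)}" "?g (j + 1) \<in> {?g (j + 1)..?g (j + 1 + 1)}"
      using g h by simp_all
    thus "\<xi> (?g (j + 1)) \<in> A" "\<xi> (?g (j + 1)) \<in> B" unfolding A B using that by blast+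
  qed
  have AB: "\<exists>w\<in>B. w - a \<in> {-?m..?M}" if "a \<in> A" for a
  proof -
    obtain \<xi> \<tau> where "a = \<xi> \<tau>" "\<xi> \<in> X" "\<tau> \<in> {?g j..?g (j + 1)}" using \<open>a \<in> A\<close> A by auto
    thus ?thesis using diff[of \<xi> \<tau> "?g (j + 1)"] g h
      by (intro bexI[OF _ node(2)[of \<xi>]]) auto
  qed
  have BA: "\<exists>w\<in>A. b - w \<in> {-?m..?M}" if "b \<in> B" for b
  proof -
    obtain \<xi> \<tau> where "b = \<xi> \<tau>" "\<xi> \<in> X" "\<tau> \<in> {?g (j + 1)..?g (j + 1 + 1)}" using \<open>b \<in> B\<close> B by auto
    thus ?thesis using diff[of \<xi> "?g (j + 1)" \<tau>] g h
      by (intro bexI[OF _ node(1)[of \<xi>]]) auto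
  qed
  obtain \<xi> where "\<xi> \<in> X" using X by blast
  hence ne: "A \<noteq> {}" "B \<noteq> {}" using node by blast+
  have bdd: "bdd_above A" "bdd_below A" "bdd_above B" "bdd_below B"
    using vals in01 by (auto simp: A_def B_def)
  show "jump_upper T N X j \<in> {- ?m..?M}" "jump_lower T N X j \<in> {- ?m..?M}"
    using Sup_Inf_differences[OF ne bdd AB BA]
    by (simp_all add: jump_upper_def jump_lower_def step_upper_def step_lower_def A_def B_def)
qed

text \<open>
  The time an envelope needs for a jump of size \<open>a\<close>. A positive jump is only possible if \<open>R > 0\<close>,
  a negative one only if \<open>r < 0\<close>; the jump 0 takes no time, for \<open>R = 0\<close> by the convention \<open>0 / 0 = 0\<close>.
\<close>

lemma jump_delay_bounds:
  fixes h :: real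
  assumes h: "0 \<le> h" and a: "a \<in> {- (max 0 (- r) * h)..max 0 R * h}"
  shows "0 \<le> a \<Longrightarrow> a / R \<in> {0..h}" "a < 0 \<Longrightarrow> a / r \<in> {0..h}"
proof -
  show "a / R \<in> {0..h}" if "0 \<le> a"
  proof (cases "R > 0")
    case True
    thus ?thesis using that a by (simp add: pos_divide_le_eq mult.commute)
  next
    case False
    hence "a = 0" using a that by simp
    thus ?thesis using h by simp
  qed
  show "a / r \<in> {0..h}" if "a < 0"
  proof (cases "r < 0")
    case True
    thus ?thesis using that a by (simp add: neg_divide_le_eq mult.commute divide_nonpos_neg)
  next
    case False
    hence "0 \<le> a" using a by simp
    thus ?thesis using that by simp
  qed
qed

lemma breakpoints_in_horizon:
  assumes T: "0 < T" "2 \<le> N" and X: "X \<noteq> {}"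
    and ramps: "bdd_above (ramps T X)" "bdd_below (ramps T X)"
    and vals: "\<And>t. t \<in> {0..T} \<Longrightarrow> bdd_above (cell_values T N X t)"
      "\<And>t. t \<in> {0..T} \<Longrightarrow> bdd_below (cell_values T N X t)"
  shows "bps_upper T N X \<subseteq> {0..T}" "bps_lower T N X \<subseteq> {0..T}"
proof -
  define h where "h = T / real (N - 1)"
  have "0 \<le> h" using T by (simp add: h_def)
  have *: "bp_upper T N X j \<in> {0..T} \<and> bp_lower T N X j \<in> {0..T}" if j: "j \<in> {1..N - 2}" for j
  proof -
    have g: "grid T N (j + 1) = grid T N j + h" "grid T N (j + 1 + 1) = grid T N (j + 1) + h"
      using grid_Suc[of j T N] grid_Suc[of "j + 1" T N] j by (auto simp: h_def)
    have in01: "0 \<le> grid T N j" "grid T N (j + 1 + 1) \<le> T"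
      using grid_bounds[OF T, of j] grid_bounds[OF T, of "j + 1 + 1"] j by auto
    note jb = jump_bounds[OF T X ramps vals j, folded h_def]
    show ?thesis
      using jump_delay_bounds[OF \<open>0 \<le> h\<close> jb(1)] jump_delay_bounds[OF \<open>0 \<le> h\<close> jb(2)] g in01
      by (auto simp: bp_upper_def bp_lower_def not_le)
  qed
  have "grid T N ` {1..N} \<subseteq> {0..T}" using grid_bounds[OF T] by auto
  thus "bps_upper T N X \<subseteq> {0..T}" "bps_lower T N X \<subseteq> {0..T}"
    using * by (auto simp: bps_upper_def bps_lower_def)
qed

lemma ends_in_breakpoints:
  assumes "2 \<le> N"
  shows "0 \<in> bps_upper T N X" "T \<in> bps_upper T N X" "0 \<in> bps_lower T N X" "T \<in> bps_lower T N X"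
proof -
  have "grid T N 1 \<in> grid T N ` {1..N}" "grid T N N \<in> grid T N ` {1..N}" using assms by auto
  thus "0 \<in> bps_upper T N X" "T \<in> bps_upper T N X" "0 \<in> bps_lower T N X" "T \<in> bps_lower T N X"
    using assms unfolding bps_upper_def bps_lower_def grid_first grid_last[OF assms] by auto
qed

section \<open>Admissible loads with prescribed local slope\<close>

lemma Omega_load_iff:
  "\<xi> \<in> Omega_load T N X \<longleftrightarrow> continuous_on {0..T} \<xi>
     \<and> (\<forall>t\<in>{0..T}. step_lower T N X t \<le> \<xi> t \<and> \<xi> t \<le> step_upper T N X t)
     \<and> (\<forall>s t. 0 \<le> s \<longrightarrow> s < t \<longrightarrow> t \<le> T \<longrightarrow>
          ramp_inf T X * (t - s) \<le> \<xi> t - \<xi> s \<and> \<xi> t - \<xi> s \<le> ramp_sup T X * (t - s))"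
proof -
  have "(\<forall>(s, t)\<in>time_pairs T. ramp_inf T X \<le> ramp \<xi> s t \<and> ramp \<xi> s t \<le> ramp_sup T X)
    \<longleftrightarrow> (\<forall>s t. 0 \<le> s \<longrightarrow> s < t \<longrightarrow> t \<le> T \<longrightarrow>
          ramp_inf T X \<le> ramp \<xi> s t \<and> ramp \<xi> s t \<le> ramp_sup T X)"
    by (auto simp: time_pairs_def)
  also have "\<dots> \<longleftrightarrow> (\<forall>s t. 0 \<le> s \<longrightarrow> s < t \<longrightarrow> t \<le> T \<longrightarrow>
          ramp_inf T X * (t - s) \<le> \<xi> t - \<xi> s \<and> \<xi> t - \<xi> s \<le> ramp_sup T X * (t - s))"
    by (simp add: ramp_def pos_le_divide_eq pos_divide_le_eq)
  finally show ?thesis unfolding Omega_load_def by simp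
qed

text \<open>
  Ramp bounds are preserved by maxima and minima, and a line of slope \<open>r\<close> satisfies them too; the
  clamping takes care of the bounds by the step functions.
\<close>

lemma Omega_load_clamped_line:
  assumes l: "l \<in> Omega_load T N X" and u: "u \<in> Omega_load T N X"
    and r: "r \<in> {ramp_inf T X..ramp_sup T X}"
  shows "(\<lambda>t. max (l t) (min (u t) (c + r * (t - a)))) \<in> Omega_load T N X"
  unfolding Omega_load_iff
proof (intro conjI ballI allI impI)
  note l = l[unfolded Omega_load_iff] and u = u[unfolded Omega_load_iff]
  show "continuous_on {0..T} (\<lambda>t. max (l t) (min (u t) (c + r * (t - a))))"
    using l u by (intro continuous_intros) auto
  fix t
  show "step_lower T N X t \<le> max (l t) (min (u t) (c + r * (t - a)))" if "t \<in> {0..T}"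
    using l u that by fastforce
  show "max (l t) (min (u t) (c + r * (t - a))) \<le> step_upper T N X t" if "t \<in> {0..T}"
    using l u that by fastforce
  fix s assume st: "0 \<le> t" "t < s" "s \<le> T"
  have "ramp_inf T X * (s - t) \<le> l s - l t \<and> l s - l t \<le> ramp_sup T X * (s - t)"
    "ramp_inf T X * (s - t) \<le> u s - u t \<and> u s - u t \<le> ramp_sup T X * (s - t)"
    using l u st by auto
  moreover have "ramp_inf T X * (s - t) \<le> r * (s - t)" "r * (s - t) \<le> ramp_sup T X * (s - t)"
    using r st by (auto intro: mult_right_mono)
  moreover have "r * (s - t) = (c + r * (s - a)) - (c + r * (t - a))" by (simp add: algebra_simps)
  ultimately show "ramp_inf T X * (s - t) \<le> max (l s) (min (u s) (c + r * (s - a))) - max (l t) (min (u t) (c + r * (t - a)))"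
    "max (l s) (min (u s) (c + r * (s - a))) - max (l t) (min (u t) (c + r * (t - a))) \<le> ramp_sup T X * (s - t)"
    by linarith+
qed

text \<open>
  A line through the midpoint of the gap between \<open>l\<close> and \<open>u\<close> at \<open>s\<close> stays strictly between them
  for a while, by continuity, so clamping does not change it near \<open>s\<close>.
\<close>

lemma exists_load_with_local_ramp:
  assumes l: "l \<in> Omega_load T N X" and u: "u \<in> Omega_load T N X"
    and r: "r \<in> {ramp_inf T X..ramp_sup T X}"
    and s: "0 \<le> s" "s < T" and less: "l s < u s"
  shows "\<exists>\<xi>\<in>Omega_load T N X. \<forall>\<^sub>F t in at_right s. \<xi> t - \<xi> s = r * (t - s)"
proof
  define c where "c = (l s + u s) / 2"
  let ?\<xi> = "\<lambda>t. max (l t) (min (u t) (c + r * (t - s)))"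
  show "?\<xi> \<in> Omega_load T N X" using l u r by (rule Omega_load_clamped_line)
  have lim: "(f \<longlongrightarrow> f s) (at_right s)" if "f \<in> Omega_load T N X" for f
    using that s by (intro continuous_on_Icc_at_rightD[of s T])
      (auto simp: Omega_load_iff elim!: continuous_on_subset)
  have mid: "l s < c" "c < u s" using less by (auto simp: c_def)
  have "((\<lambda>t. c + r * (t - s) - l t) \<longlongrightarrow> c + r * (s - s) - l s) (at_right s)"
    by (intro tendsto_intros lim l)
  hence "\<forall>\<^sub>F t in at_right s. 0 < c + r * (t - s) - l t"
    by (rule order_tendstoD(1)) (use mid in simp)
  moreover have "((\<lambda>t. u t - (c + r * (t - s))) \<longlongrightarrow> u s - (c + r * (s - s))) (at_right s)"
    by (intro tendsto_intros lim u)
  hence "\<forall>\<^sub>F t in at_right s. 0 < u t - (c + r * (t - s))"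
    by (rule order_tendstoD(1)) (use mid in simp)
  ultimately show "\<forall>\<^sub>F t in at_right s. ?\<xi> t - ?\<xi> s = r * (t - s)"
  proof eventually_elim
    case (elim t)
    thus ?case using mid by auto
  qed
qed

section \<open>Ramps within a cell\<close>

text \<open>
  The demand data together with the extremality of the envelopes. Nonempty \<open>\<Xi> d\<close>
  make the suprema and infima meaningful and put the ramp bounds in the right order.
\<close>

locale load_setting =
  fixes T :: real and N :: nat and \<Xi> :: "'d::finite \<Rightarrow> (real \<Rightarrow> real) set"
  assumes T: "0 < T" and N: "2 \<le> N" and nonempty: "\<And>d. \<Xi> d \<noteq> {}"
    and ramps: "\<And>d. bdd_above (ramps T (\<Xi> d))" "\<And>d. bdd_below (ramps T (\<Xi> d))"
    and vals: "\<And>d t. t \<in> {0..T} \<Longrightarrow> bdd_above (cell_values T N (\<Xi> d) t)"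
      "\<And>d t. t \<in> {0..T} \<Longrightarrow> bdd_below (cell_values T N (\<Xi> d) t)"
    and env_mem: "\<And>d. env_upper T N (\<Xi> d) \<in> Omega_load T N (\<Xi> d)"
      "\<And>d. env_lower T N (\<Xi> d) \<in> Omega_load T N (\<Xi> d)"
    and env_extremal: "\<And>d \<xi> t. \<xi> \<in> Omega_load T N (\<Xi> d) \<Longrightarrow> t \<in> {0..T} \<Longrightarrow>
         env_lower T N (\<Xi> d) t \<le> \<xi> t \<and> \<xi> t \<le> env_upper T N (\<Xi> d) t"
begin

abbreviation "p \<equiv> bp T N \<Xi>"
abbreviation "M \<equiv> num_bps T N \<Xi>"

lemma ramp_inf_le_sup: "ramp_inf T (\<Xi> d) \<le> ramp_sup T (\<Xi> d)"
proof -
  obtain \<xi> where "\<xi> \<in> \<Xi> d" using nonempty by blast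
  hence "ramp_inf T (\<Xi> d) * T \<le> \<xi> T - \<xi> 0" "\<xi> T - \<xi> 0 \<le> ramp_sup T (\<Xi> d) * T"
    using ramp_bounds[OF ramps, of \<xi> d 0 T] T by simp_all
  hence "ramp_inf T (\<Xi> d) * T \<le> ramp_sup T (\<Xi> d) * T" by (rule order_trans)
  thus ?thesis using T by (simp only: mult_le_cancel_right_pos)
qed

lemma finite_bps: "finite (bps T N \<Xi>)"
  by (auto simp: bps_def bps_upper_def bps_lower_def)

lemma bps_bounds: "x \<in> bps T N \<Xi> \<Longrightarrow> 0 \<le> x \<and> x \<le> T"
  using breakpoints_in_horizon[OF T N nonempty ramps vals] by (fastforce simp: bps_def)

lemma ends_in_bps: "0 \<in> bps T N \<Xi>" "T \<in> bps T N \<Xi>"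
  using ends_in_breakpoints[OF N] by (auto simp: bps_def)

lemma strict_mono_on_bp: "strict_mono_on {1..M} p"
  unfolding bp_def num_bps_def by (rule strict_mono_on_nth_point)

lemma bp_ends: "p 1 = 0" "p M = T"
  unfolding bp_def num_bps_def using nth_point_ends[OF finite_bps ends_in_bps bps_bounds] by auto

lemma two_le_num_bps: "2 \<le> M"
proof -
  have "card {0, T} \<le> M" unfolding num_bps_def using finite_bps ends_in_bps by (intro card_mono) auto
  thus ?thesis using T by simp
qed

lemma bp_cell:
  assumes j: "j \<in> {1..M - 1}"
  shows "0 \<le> p j" "p j < p (j + 1)" "p (j + 1) \<le> T"
proof -
  show "p j < p (j + 1)" using strict_mono_onD[OF strict_mono_on_bp] j by auto
  have "p i \<in> bps T N \<Xi>" if "i \<in> {1..M}" for i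
    using that unfolding bp_def num_bps_def by (rule nth_point_mem[OF finite_bps])
  thus "0 \<le> p j" "p (j + 1) \<le> T" using bps_bounds j by auto
qed


lemma pw_affine_on_bp_cell:
  assumes j: "j \<in> {1..M - 1}" and B: "B \<subseteq> bps T N \<Xi>" "0 \<in> B" "T \<in> B"
  obtains c m where "\<And>t. t \<in> {p j..p (j + 1)} \<Longrightarrow> pw_affine B P t = c + m * t"
proof (rule pw_affine_affine_off_breakpoints)
  show "finite B" using B(1) finite_bps by (rule finite_subset)
  show "0 \<in> B" "T \<in> B" "\<And>x. x \<in> B \<Longrightarrow> 0 \<le> x \<and> x \<le> T" using B bps_bounds by auto
  show "0 \<le> p j" "p j < p (j + 1)" "p (j + 1) \<le> T" using bp_cell[OF j] by auto
  show "{p j<..<p (j + 1)} \<inter> B = {}"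
    using no_point_between_consecutive[OF finite_bps, of j] j B(1)
    unfolding bp_def num_bps_def by blast
qed (rule that)

lemma envelopes_affine_on_bp_cell:
  assumes j: "j \<in> {1..M - 1}"
  obtains c m c' m' where "\<And>t. t \<in> {p j..p (j + 1)} \<Longrightarrow> env_upper T N (\<Xi> d) t = c + m * t"
    and "\<And>t. t \<in> {p j..p (j + 1)} \<Longrightarrow> env_lower T N (\<Xi> d) t = c' + m' * t"
proof -
  have "bps_upper T N (\<Xi> d) \<subseteq> bps T N \<Xi>" "bps_lower T N (\<Xi> d) \<subseteq> bps T N \<Xi>"
    by (auto simp: bps_def)
  thus ?thesis
    using pw_affine_on_bp_cell[OF j, of "bps_upper T N (\<Xi> d)" "points_upper T N (\<Xi> d)"]
      pw_affine_on_bp_cell[OF j, of "bps_lower T N (\<Xi> d)" "points_lower T N (\<Xi> d)"]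
      ends_in_breakpoints[OF N] that
    unfolding env_upper_def env_lower_def by metis
qed

text \<open>
  Two affine functions that agree at two distinct points are equal.
\<close>

lemma envelopes_coincide:
  assumes j: "j \<in> {1..M - 1}" and meet: "envs_meet T N \<Xi> d j" and t: "t \<in> {p j..p (j + 1)}"
  shows "env_upper T N (\<Xi> d) t = env_upper T N (\<Xi> d) (p j) + env_slope T N \<Xi> d j * (t - p j)"
    and "env_lower T N (\<Xi> d) t = env_upper T N (\<Xi> d) t"
proof -
  obtain c m c' m' where
    u: "\<And>t. t \<in> {p j..p (j + 1)} \<Longrightarrow> env_upper T N (\<Xi> d) t = c + m * t" and
    l: "\<And>t. t \<in> {p j..p (j + 1)} \<Longrightarrow> env_lower T N (\<Xi> d) t = c' + m' * t"
    using envelopes_affine_on_bp_cell[OF j] by blast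
  have p: "p j < p (j + 1)" using bp_cell[OF j] by simp
  hence ends: "p j \<in> {p j..p (j + 1)}" "p (j + 1) \<in> {p j..p (j + 1)}" by auto
  have "env_slope T N \<Xi> d j = m"
    using p unfolding env_slope_def bp_gap_def u[OF ends(1)] u[OF ends(2)] by (simp add: field_simps)
  thus "env_upper T N (\<Xi> d) t = env_upper T N (\<Xi> d) (p j) + env_slope T N \<Xi> d j * (t - p j)"
    by (simp add: u[OF t] u[OF ends(1)] algebra_simps)
  have eq: "c + m * p j = c' + m' * p j" "c + m * p (j + 1) = c' + m' * p (j + 1)"
    using meet u[OF ends(1)] u[OF ends(2)] l[OF ends(1)] l[OF ends(2)] by (auto simp: envs_meet_def)
  hence "(m - m') * (p (j + 1) - p j) = 0" by (simp add: algebra_simps)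
  hence "m = m'" using p by simp
  moreover from this have "c = c'" using eq by simp
  ultimately show "env_lower T N (\<Xi> d) t = env_upper T N (\<Xi> d) t" using u[OF t] l[OF t] by simp
qed

text \<open>
  At the midpoint the gap of the two affine envelopes is the mean of the gaps at the ends, which are
  nonnegative and not both zero.
\<close>

lemma envelopes_strict_at_midpoint:
  assumes j: "j \<in> {1..M - 1}" and apart: "\<not> envs_meet T N \<Xi> d j"
  shows "env_lower T N (\<Xi> d) ((p j + p (j + 1)) / 2) < env_upper T N (\<Xi> d) ((p j + p (j + 1)) / 2)"
proof -
  obtain c m c' m' where
    u: "\<And>t. t \<in> {p j..p (j + 1)} \<Longrightarrow> env_upper T N (\<Xi> d) t = c + m * t" and
    l: "\<And>t. t \<in> {p j..p (j + 1)} \<Longrightarrow> env_lower T N (\<Xi> d) t = c' + m' * t"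
    using envelopes_affine_on_bp_cell[OF j] by blast
  note p = bp_cell[OF j]
  hence in_cell: "p j \<in> {p j..p (j + 1)}" "p (j + 1) \<in> {p j..p (j + 1)}"
    "(p j + p (j + 1)) / 2 \<in> {p j..p (j + 1)}" by auto
  have le: "env_lower T N (\<Xi> d) (p j) \<le> env_upper T N (\<Xi> d) (p j)"
    "env_lower T N (\<Xi> d) (p (j + 1)) \<le> env_upper T N (\<Xi> d) (p (j + 1))"
    using env_extremal[OF env_mem(1), of _ d] p by auto
  have "c' + m' * p j < c + m * p j \<and> c' + m' * p (j + 1) \<le> c + m * p (j + 1)
      \<or> c' + m' * p j \<le> c + m * p j \<and> c' + m' * p (j + 1) < c + m * p (j + 1)"
    using le apart unfolding envs_meet_def u[OF in_cell(1)] u[OF in_cell(2)] l[OF in_cell(1)] l[OF in_cell(2)]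
    by linarith
  thus ?thesis unfolding u[OF in_cell(3)] l[OF in_cell(3)] by (auto simp: field_simps)
qed

lemma ramp_inf'_le_ramp_sup': "ramp_inf' T N \<Xi> j \<le> ramp_sup' T N \<Xi> j"
  using ramp_inf_le_sup by (auto simp: less_eq_vec_def ramp_inf'_def ramp_sup'_def)

text \<open>
  Where the envelopes meet, an admissible load has no freedom: it is squeezed to their common affine
  function. This is the reason for the primed ramp bounds.
\<close>

lemma ramp_in_bp_cell:
  assumes \<xi>: "\<xi> \<in> Omega T N \<Xi>" and j: "j \<in> {1..M - 1}" and st: "p j \<le> s" "s < t" "t \<le> p (j + 1)"
  shows "ramp_inf' T N \<Xi> j \<le> (\<xi> t - \<xi> s) /\<^sub>R (t - s)" "(\<xi> t - \<xi> s) /\<^sub>R (t - s) \<le> ramp_sup' T N \<Xi> j"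
proof -
  have "ramp_inf' T N \<Xi> j $ d \<le> (\<xi> t $ d - \<xi> s $ d) / (t - s)
      \<and> (\<xi> t $ d - \<xi> s $ d) / (t - s) \<le> ramp_sup' T N \<Xi> j $ d" for d
  proof (cases "envs_meet T N \<Xi> d j")
    case True
    have "\<xi> x $ d = env_upper T N (\<Xi> d) (p j) + env_slope T N \<Xi> d j * (x - p j)"
      if "x \<in> {p j..p (j + 1)}" for x
    proof -
      have "x \<in> {0..T}" using that bp_cell[OF j] by auto
      hence "env_lower T N (\<Xi> d) x \<le> \<xi> x $ d \<and> \<xi> x $ d \<le> env_upper T N (\<Xi> d) x"
        using \<xi> by (intro env_extremal) (auto simp: Omega_def)
      thus ?thesis using envelopes_coincide[OF j True that] by simp
    qed
    hence "\<xi> t $ d - \<xi> s $ d = env_slope T N \<Xi> d j * (t - s)"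
      using st by (simp add: right_diff_distrib)
    thus ?thesis using st True by (simp add: ramp_inf'_def ramp_sup'_def)
  next
    case False
    have "(\<lambda>t. \<xi> t $ d) \<in> Omega_load T N (\<Xi> d)" using \<xi> by (simp add: Omega_def)
    thus ?thesis using st False bp_cell[OF j]
      by (simp add: Omega_load_iff ramp_inf'_def ramp_sup'_def pos_le_divide_eq pos_divide_le_eq)
  qed
  thus "ramp_inf' T N \<Xi> j \<le> (\<xi> t - \<xi> s) /\<^sub>R (t - s)" "(\<xi> t - \<xi> s) /\<^sub>R (t - s) \<le> ramp_sup' T N \<Xi> j"
    by (auto simp: less_eq_vec_def divide_inverse mult.commute)
qed

text \<open>
  The box between the primed ramp bounds cannot be made smaller. All loads are made to ramp
  from the same point \<open>s\<close>, the midpoint of the cell, so that the loads can be combined.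
\<close>

lemma ramp_attained_in_bp_cell:
  assumes j: "j \<in> {1..M - 1}" and \<rho>: "ramp_inf' T N \<Xi> j \<le> \<rho>" "\<rho> \<le> ramp_sup' T N \<Xi> j"
  obtains \<xi> s t where "\<xi> \<in> Omega T N \<Xi>" "p j \<le> s" "s < t" "t \<le> p (j + 1)" "(\<xi> t - \<xi> s) /\<^sub>R (t - s) = \<rho>"
proof -
  define s where "s = (p j + p (j + 1)) / 2"
  note p = bp_cell[OF j]
  have s: "p j < s" "s < p (j + 1)" using p by (auto simp: s_def)
  have near: "\<forall>\<^sub>F t in at_right s. t \<in> {s<..<p (j + 1)}"
    using s(2) by (rule eventually_at_right_real)
  have "\<exists>f\<in>Omega_load T N (\<Xi> d). \<forall>\<^sub>F t in at_right s. f t - f s = \<rho> $ d * (t - s)" for d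
  proof (cases "envs_meet T N \<Xi> d j")
    case True
    hence "\<rho> $ d = env_slope T N \<Xi> d j"
      using \<rho> by (auto simp: less_eq_vec_def ramp_inf'_def ramp_sup'_def intro: antisym
          elim!: allE[of _ d])
    moreover have "\<forall>\<^sub>F t in at_right s. env_upper T N (\<Xi> d) t - env_upper T N (\<Xi> d) s
        = env_slope T N \<Xi> d j * (t - s)"
      using near
    proof eventually_elim
      case (elim t)
      thus ?case using envelopes_coincide(1)[OF j True, of t] envelopes_coincide(1)[OF j True, of s] s
        by (simp add: right_diff_distrib)
    qed
    ultimately show ?thesis using env_mem(1)[of d] by auto
  next
    case False
    hence "\<rho> $ d \<in> {ramp_inf T (\<Xi> d)..ramp_sup T (\<Xi> d)}"
      using \<rho> by (auto simp: less_eq_vec_def ramp_inf'_def ramp_sup'_def elim!: allE[of _ d])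
    thus ?thesis
      using envelopes_strict_at_midpoint[OF j False] s p
      by (intro exists_load_with_local_ramp[OF env_mem(2) env_mem(1)]) (auto simp: s_def)
  qed
  then obtain f where f: "\<And>d. f d \<in> Omega_load T N (\<Xi> d)"
    "\<And>d. \<forall>\<^sub>F t in at_right s. f d t - f d s = \<rho> $ d * (t - s)"
    by metis
  have "\<forall>\<^sub>F t in at_right s. \<forall>d. f d t - f d s = \<rho> $ d * (t - s)"
    using f(2) by (rule eventually_all_finite)
  hence "\<forall>\<^sub>F t in at_right s. t \<in> {s<..<p (j + 1)} \<and> (\<forall>d. f d t - f d s = \<rho> $ d * (t - s))"
    using near by (rule eventually_conj[rotated])
  then obtain t where t: "t \<in> {s<..<p (j + 1)}" "\<And>d. f d t - f d s = \<rho> $ d * (t - s)"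
    using eventually_happens'[OF trivial_limit_at_right_real] by blast
  show ?thesis
  proof (rule that)
    show "(\<lambda>t. \<chi> d. f d t) \<in> Omega T N \<Xi>" using f(1) by (simp add: Omega_def)
    show "((\<chi> d. f d t) - (\<chi> d. f d s)) /\<^sub>R (t - s) = \<rho>"
      using t by (simp add: vec_eq_iff)
  qed (use s t in auto)
qed

text \<open>
  The affine part of the decision rule is an interpolation of the \<open>\<beta> j\<close>. The value \<open>1\<close> of
  \<open>bp_frac\<close> at \<open>T\<close> is the one that the general formula gives on the last cell.
\<close>

lemma x_hat_on_bp_cell:
  assumes j: "j \<in> {1..M - 1}" and t: "t \<in> {p j..p (j + 1)}"
  shows "x_hat T N \<Xi> \<alpha> \<beta> \<xi> t
    = \<alpha> *v \<xi> t + (\<beta> j + ((t - p j) / bp_gap T N \<Xi> j) *\<^sub>R (\<beta> (j + 1) - \<beta> j))"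
proof -
  let ?i = "cell p M t"
  have "p (M - 1) < p M" using bp_cell(2)[of "M - 1"] two_le_num_bps by auto
  hence frac: "bp_frac T N \<Xi> t = (t - p ?i) / (p (?i + 1) - p ?i)"
    using cell_last[of p M] two_le_num_bps bp_ends(2)
    by (auto simp: bp_frac_def bp_gap_def bp_index_def)
  have "x_hat T N \<Xi> \<alpha> \<beta> \<xi> t
    = \<alpha> *v \<xi> t + (\<beta> ?i + ((t - p ?i) / (p (?i + 1) - p ?i)) *\<^sub>R (\<beta> (?i + 1) - \<beta> ?i))"
    unfolding x_hat_def frac by (simp add: bp_index_def algebra_simps)
  also have "\<beta> ?i + ((t - p ?i) / (p (?i + 1) - p ?i)) *\<^sub>R (\<beta> (?i + 1) - \<beta> ?i)
      = \<beta> j + ((t - p j) / (p (j + 1) - p j)) *\<^sub>R (\<beta> (j + 1) - \<beta> j)"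
    by (rule interpolation_on_closed_cell[OF strict_mono_on_bp j t])
  finally show ?thesis by (simp add: bp_gap_def)
qed

lemma x_hat_ramp_on_bp_cell:
  assumes j: "j \<in> {1..M - 1}" and st: "p j \<le> s" "s < t" "t \<le> p (j + 1)"
  shows "(x_hat T N \<Xi> \<alpha> \<beta> \<xi> t - x_hat T N \<Xi> \<alpha> \<beta> \<xi> s) /\<^sub>R (t - s)
    = \<alpha> *v ((\<xi> t - \<xi> s) /\<^sub>R (t - s)) + (\<beta> (j + 1) - \<beta> j) /\<^sub>R bp_gap T N \<Xi> j"
proof -
  let ?D = "bp_gap T N \<Xi> j" let ?b = "\<beta> (j + 1) - \<beta> j"
  have "x_hat T N \<Xi> \<alpha> \<beta> \<xi> t - x_hat T N \<Xi> \<alpha> \<beta> \<xi> s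
      = \<alpha> *v (\<xi> t - \<xi> s) + ((t - p j) / ?D - (s - p j) / ?D) *\<^sub>R ?b"
    using st by (simp add: x_hat_on_bp_cell[OF j] matrix_vector_mult_diff_distrib scaleR_left_diff_distrib)
  also have "(t - p j) / ?D - (s - p j) / ?D = (t - s) * inverse ?D"
    by (simp add: divide_inverse algebra_simps)
  finally show ?thesis
    using st by (simp add: scaleR_add_right matrix_vector_mult_scaleR)
qed

text \<open>
  Necessity takes an admissible load that realises \<open>\<rho>\<close>. For sufficiency, the limits hold on each
  cell because no ramp vector leaves the box, and monotonicity carries them across cells.
\<close>

lemma x_hat_ramp_limits_iff:
  "(\<forall>\<xi>\<in>Omega T N \<Xi>. \<forall>(t1, t2)\<in>time_pairs T.
      R_down \<le> (x_hat T N \<Xi> \<alpha> \<beta> \<xi> t2 - x_hat T N \<Xi> \<alpha> \<beta> \<xi> t1) /\<^sub>R (t2 - t1)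
    \<and> (x_hat T N \<Xi> \<alpha> \<beta> \<xi> t2 - x_hat T N \<Xi> \<alpha> \<beta> \<xi> t1) /\<^sub>R (t2 - t1) \<le> R_up)
   \<longleftrightarrow> (\<forall>j\<in>{1..M - 1}. \<forall>\<rho>. ramp_inf' T N \<Xi> j \<le> \<rho> \<longrightarrow> \<rho> \<le> ramp_sup' T N \<Xi> j \<longrightarrow>
      R_down \<le> \<alpha> *v \<rho> + (\<beta> (j + 1) - \<beta> j) /\<^sub>R bp_gap T N \<Xi> j
    \<and> \<alpha> *v \<rho> + (\<beta> (j + 1) - \<beta> j) /\<^sub>R bp_gap T N \<Xi> j \<le> R_up)" (is "?lhs \<longleftrightarrow> ?rhs")
proof
  assume lhs: ?lhs
  show ?rhs
  proof (intro ballI allI impI)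
    fix j \<rho> assume j: "j \<in> {1..M - 1}" and \<rho>: "ramp_inf' T N \<Xi> j \<le> \<rho>" "\<rho> \<le> ramp_sup' T N \<Xi> j"
    obtain \<xi> s t where \<xi>: "\<xi> \<in> Omega T N \<Xi>" and st: "p j \<le> s" "s < t" "t \<le> p (j + 1)"
      and "(\<xi> t - \<xi> s) /\<^sub>R (t - s) = \<rho>"
      using ramp_attained_in_bp_cell[OF j \<rho>] by blast
    moreover have "(s, t) \<in> time_pairs T" using st bp_cell[OF j] by (simp add: time_pairs_def)
    ultimately show "R_down \<le> \<alpha> *v \<rho> + (\<beta> (j + 1) - \<beta> j) /\<^sub>R bp_gap T N \<Xi> j
        \<and> \<alpha> *v \<rho> + (\<beta> (j + 1) - \<beta> j) /\<^sub>R bp_gap T N \<Xi> j \<le> R_up"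
      using lhs x_hat_ramp_on_bp_cell[OF j st, of \<alpha> \<beta> \<xi>] by fastforce
  qed
next
  assume rhs: ?rhs
  show ?lhs
  proof
    fix \<xi> assume \<xi>: "\<xi> \<in> Omega T N \<Xi>"
    let ?x = "x_hat T N \<Xi> \<alpha> \<beta> \<xi>"
    have cellwise: "mono_on {p j..p (j + 1)} (\<lambda>t. ?x t - t *\<^sub>R R_down)
        \<and> mono_on {p j..p (j + 1)} (\<lambda>t. t *\<^sub>R R_up - ?x t)" if j: "j \<in> {1..M - 1}" for j
      unfolding difference_quotient_bounds_iff_mono[symmetric]
    proof (intro ballI impI)
      fix s t assume "s \<in> {p j..p (j + 1)}" "t \<in> {p j..p (j + 1)}" "s < t"
      hence st: "p j \<le> s" "s < t" "t \<le> p (j + 1)" by auto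
      show "R_down \<le> (?x t - ?x s) /\<^sub>R (t - s) \<and> (?x t - ?x s) /\<^sub>R (t - s) \<le> R_up"
        unfolding x_hat_ramp_on_bp_cell[OF j st] using rhs j ramp_in_bp_cell[OF \<xi> j st] by blast
    qed
    have "mono_on {p 1..p M} (\<lambda>t. ?x t - t *\<^sub>R R_down) \<and> mono_on {p 1..p M} (\<lambda>t. t *\<^sub>R R_up - ?x t)"
      by (intro conjI mono_on_glue) (use two_le_num_bps bp_cell cellwise in \<open>auto intro: less_imp_le\<close>)
    thus "\<forall>(t1, t2)\<in>time_pairs T. R_down \<le> (?x t2 - ?x t1) /\<^sub>R (t2 - t1)
        \<and> (?x t2 - ?x t1) /\<^sub>R (t2 - t1) \<le> R_up"
      unfolding difference_quotient_bounds_iff_mono[symmetric] bp_ends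
      by (auto simp: time_pairs_def)
  qed
qed

end

section \<open>The robust ramp constraints\<close>

theorem proposition3:
  fixes T :: real and N :: nat
    and \<Xi> :: "'d::finite \<Rightarrow> (real \<Rightarrow> real) set"
    and R_up R_down :: "real ^ 'g::finite"
    and \<sigma> :: "nat \<Rightarrow> real ^ 'd"
    and \<alpha> :: "real ^ 'd ^ 'g" and \<beta> :: "nat \<Rightarrow> real ^ 'g"
  assumes "0 < T" and "2 \<le> N"
    and "0 \<le> R_up" and "R_down \<le> 0"
    and two_elements: "\<And>d. \<exists>\<xi>\<in>\<Xi> d. \<exists>\<eta>\<in>\<Xi> d. \<exists>t\<in>{0..T}. \<xi> t \<noteq> \<eta> t"
    and "\<And>d. bdd_above (ramps T (\<Xi> d))" and "\<And>d. bdd_below (ramps T (\<Xi> d))"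
    and "\<And>d t. t \<in> {0..T} \<Longrightarrow> bdd_above (cell_values T N (\<Xi> d) t)"
    and "\<And>d t. t \<in> {0..T} \<Longrightarrow> bdd_below (cell_values T N (\<Xi> d) t)"
    and envelopes_in_Omega:
      "\<And>d. env_upper T N (\<Xi> d) \<in> Omega_load T N (\<Xi> d)"
      "\<And>d. env_lower T N (\<Xi> d) \<in> Omega_load T N (\<Xi> d)"
    and envelopes_extremal:
      "\<And>d \<xi> t. \<xi> \<in> Omega_load T N (\<Xi> d) \<Longrightarrow> t \<in> {0..T} \<Longrightarrow>
         env_lower T N (\<Xi> d) t \<le> \<xi> t \<and> \<xi> t \<le> env_upper T N (\<Xi> d) t"
    and envelopes_range:
      "\<And>d t. t \<in> {0..T} \<Longrightarrow>
         (\<lambda>\<xi>. \<xi> t) ` Omega_load T N (\<Xi> d) = {env_lower T N (\<Xi> d) t..env_upper T N (\<Xi> d) t}"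
    and enumeration:
      "bij_betw \<sigma> {1..2 ^ CARD('d)} {s :: real ^ 'd. \<forall>d. s $ d \<in> {0, 1}}"
  shows "(\<forall>\<xi>\<in>Omega T N \<Xi>. \<forall>(t1, t2)\<in>time_pairs T.
            R_down \<le> (x_hat T N \<Xi> \<alpha> \<beta> \<xi> t2 - x_hat T N \<Xi> \<alpha> \<beta> \<xi> t1) /\<^sub>R (t2 - t1)
          \<and> (x_hat T N \<Xi> \<alpha> \<beta> \<xi> t2 - x_hat T N \<Xi> \<alpha> \<beta> \<xi> t1) /\<^sub>R (t2 - t1) \<le> R_up)
     \<longleftrightarrow> (\<forall>j\<in>{1..num_bps T N \<Xi> - 1}. \<forall>l\<in>{1..2 ^ CARD('d)}.
            R_down \<le> \<alpha> *v (ramp_inf' T N \<Xi> j + \<sigma> l * (ramp_sup' T N \<Xi> j - ramp_inf' T N \<Xi> j))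
                    + (\<beta> (j + 1) - \<beta> j) /\<^sub>R bp_gap T N \<Xi> j
          \<and> \<alpha> *v (ramp_inf' T N \<Xi> j + \<sigma> l * (ramp_sup' T N \<Xi> j - ramp_inf' T N \<Xi> j))
                    + (\<beta> (j + 1) - \<beta> j) /\<^sub>R bp_gap T N \<Xi> j \<le> R_up)"
proof -
  interpret load_setting T N \<Xi>
  proof (rule load_setting.intro)
    show "\<Xi> d \<noteq> {}" for d using two_elements[of d] by blast
  qed (rule assms; assumption)+
  have image: "\<sigma> ` {1..2 ^ CARD('d)} = {s. \<forall>d. s $ d \<in> {0, 1}}"
    using enumeration by (rule bij_betw_imp_surj_on)
  have vertices: "(\<forall>s\<in>{s. \<forall>d. s $ d \<in> {0, 1}}. Q s) \<longleftrightarrow> (\<forall>l\<in>{1..2 ^ CARD('d)}. Q (\<sigma> l))" for Q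
    unfolding image[symmetric] by (simp only: ball_simps)
  show ?thesis
    unfolding x_hat_ramp_limits_iff matrix_bounds_on_box_iff_vertices[OF ramp_inf'_le_ramp_sup'] vertices
    by (rule refl)
qed

end
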